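(* Let $$Q=\begin{pmatrix} \frac14 & -\frac12 & 0 & 0 \\ -\frac12 & 1 & -1 & 0 \\ 0 & -1 & 1 & -\frac12 \\ 0 & 0 & -\frac12 & \frac14 \end{pmatrix},\qquad c=\begin{pmatrix} \frac12 \\ 1 \\ 0 \\ 0 \end{pmatrix}.$$ Then the problem $$\min_{(x,X)\in\mathcal{S}_4,\ y\in\Delta_{16}}\ Q\bullet X+c^\top x\quad\text{s.t.}\quad (x,(X_{ij})_{i<j})=y_1P_1+\cdots+y_{16}P_{16}$$ has a feasible solution $(x^{\rm BQP},X^{\rm BQP},y^{\rm BQP})$ with objective value $-1/100$.
   Context: $\mathbb{S}^4$ is the space of real symmetric $4\times4$ matrices, $Q\bullet X=\sum_{i,j}Q_{ij}X_{ij}$, and $$\mathcal{S}_4=\Big\{(x,X)\in\mathbb{R}^4\times\mathbb{S}^4:\begin{pmatrix} 1 & x^\top \\ x & X \end{pmatrix}\succeq0\Big\}.$$ $\Delta_{16}=\{y\in\mathbb{R}^{16}:\sum_iy_i=1,\ y\ge0\}$. $P_1,\dots,P_{16}$ are the sixteen vertices of the Boolean quadric polytope $\mathcal{B}_4=\mathrm{conv}\{(z,(z_iz_j)_{i<j}):z\in\{0,1\}^4\}$, i.e. the points $(z,(z_iz_j)_{i<j})$ for $z\in\{0,1\}^4$. *)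

theory Defs
  imports "HOL-Analysis.Analysis"
begin

definition psd_matrix :: "real^'n^'n \<Rightarrow> bool" where
  "psd_matrix A \<longleftrightarrow> transpose A = A \<and> (\<forall>v. 0 \<le> v \<bullet> (A *v v))"

text \<open>The block matrix with rows \<open>(1, x\<^sup>T)\<close> and \<open>(x, X)\<close>; the index type \<open>1 + 'n\<close> is the
  disjoint sum of a singleton type and \<open>'n\<close>.\<close>

definition bordered_matrix :: "real^'n \<Rightarrow> real^'n^'n \<Rightarrow> real^(1 + 'n)^(1 + 'n)" where
  "bordered_matrix x X = (\<chi> i j. case (i, j) of
      (Inl _, Inl _) \<Rightarrow> 1
    | (Inl _, Inr l) \<Rightarrow> x $ l
    | (Inr k, Inl _) \<Rightarrow> x $ k
    | (Inr k, Inr l) \<Rightarrow> X $ k $ l)"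

definition shor_set :: "((real^'n) \<times> (real^'n^'n)) set" where
  "shor_set = {(x, X). transpose X = X \<and> psd_matrix (bordered_matrix x X)}"

definition std_simplex :: "(real^'n) set" where
  "std_simplex = {y. (\<Sum>i\<in>UNIV. y $ i) = 1 \<and> (\<forall>i. 0 \<le> y $ i)}"

text \<open>The pairs \<open>i < j\<close> are listed explicitly: in the library's order on the numeral type \<open>4\<close>,
  the element \<open>4 = 0\<close> is the least one.\<close>

definition upper_entries :: "real^4^4 \<Rightarrow> real^6" where
  "upper_entries X = vector [X$1$2, X$1$3, X$1$4, X$2$3, X$2$4, X$3$4]"

definition binary_points :: "(real^'n) set" where
  "binary_points = {z. \<forall>i. z $ i \<in> {0, 1}}"

definition bqp_point :: "real^4 \<Rightarrow> (real^4) \<times> (real^6)" where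
  "bqp_point z = (z, upper_entries (\<chi> i j. z $ i * z $ j))"

definition boolean_quadric_polytope :: "((real^4) \<times> (real^6)) set" where
  "boolean_quadric_polytope = convex hull (bqp_point ` binary_points)"

definition bqp_vertices :: "((real^4) \<times> (real^6)) set" where
  "bqp_vertices = {p. p extreme_point_of boolean_quadric_polytope}"

definition bqp_feasible ::
    "(16 \<Rightarrow> (real^4) \<times> (real^6)) \<Rightarrow> ((real^4) \<times> (real^4^4) \<times> (real^16)) set" where
  "bqp_feasible P = {(x, X, y). (x, X) \<in> shor_set \<and> y \<in> std_simplex \<and>
     (x, upper_entries X) = (\<Sum>k\<in>UNIV. y $ k *\<^sub>R P k)}"

text \<open>The library inner product on matrices is \<open>Q \<bullet> X = (\<Sum>i j. Q$i$j * X$i$j)\<close>.\<close>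

definition qp_objective :: "real^'n^'n \<Rightarrow> real^'n \<Rightarrow> real^'n \<Rightarrow> real^'n^'n \<Rightarrow> real" where
  "qp_objective Q c x X = Q \<bullet> X + c \<bullet> x"

lemma vector_4:
  "(vector [a, b, c, d] :: 'a::zero^4) $ 1 = a"
  "(vector [a, b, c, d] :: 'a::zero^4) $ 2 = b"
  "(vector [a, b, c, d] :: 'a::zero^4) $ 3 = c"
  "(vector [a, b, c, d] :: 'a::zero^4) $ 4 = d"
  unfolding vector_def by simp_all

lemma vector_6:
  "(vector [a, b, c, d, e, f] :: 'a::zero^6) $ 1 = a"
  "(vector [a, b, c, d, e, f] :: 'a::zero^6) $ 2 = b"
  "(vector [a, b, c, d, e, f] :: 'a::zero^6) $ 3 = c"
  "(vector [a, b, c, d, e, f] :: 'a::zero^6) $ 4 = d"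
  "(vector [a, b, c, d, e, f] :: 'a::zero^6) $ 5 = e"
  "(vector [a, b, c, d, e, f] :: 'a::zero^6) $ 6 = f"
  unfolding vector_def by simp_all

lemma binary_points_eq:
  "(binary_points :: (real^'n) set) = range (\<lambda>S. \<chi> i. of_bool (i \<in> S))"
proof (intro equalityI subsetI)
  fix z :: "real^'n" assume "z \<in> binary_points"
  then have "z = (\<chi> i. of_bool (i \<in> {i. z $ i = 1}))"
    by (auto simp: binary_points_def vec_eq_iff)
  then show "z \<in> range (\<lambda>S. \<chi> i. of_bool (i \<in> S))" by blast
qed (auto simp: binary_points_def)

lemma card_binary_points: "card (binary_points :: (real^'n) set) = 2 ^ CARD('n)"
proof -
  have "inj (\<lambda>S. (\<chi> i. of_bool (i \<in> S)) :: real^'n)"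
    by (auto simp: inj_def vec_eq_iff)
  then show ?thesis
    by (simp add: binary_points_eq card_image card_Pow flip: Pow_UNIV)
qed

lemma finite_binary_points: "finite (binary_points :: (real^'n) set)"
  by (simp add: binary_points_eq)

lemma bqp_vertices_eq: "bqp_vertices = bqp_point ` binary_points"
proof -
  let ?S = "bqp_point ` binary_points"
  have indep: "a \<notin> convex hull (?S - {a})" if "a \<in> ?S" for a
  proof -
    from that obtain z where z: "z \<in> binary_points" and a: "a = bqp_point z" by blast
    define d :: "real^4" where "d = (\<chi> i. 2 * z $ i - 1)"
    define h where "h = (d, 0 :: real^6)"
    have lt: "h \<bullet> p < h \<bullet> a" if p: "p \<in> ?S - {a}" for p
    proof -
      from p obtain w where w: "w \<in> binary_points" "p = bqp_point w" by blast
      with p a have "w \<noteq> z" by auto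
      then obtain i where i: "w $ i \<noteq> z $ i" by (auto simp: vec_eq_iff)
      have bin: "z $ j = 0 \<or> z $ j = 1" "w $ j = 0 \<or> w $ j = 1" for j
        using z w(1) by (auto simp: binary_points_def)
      have "d $ j * w $ j \<le> d $ j * z $ j" for j
        using bin[of j] by (auto simp: d_def)
      moreover have "d $ i * w $ i < d $ i * z $ i"
        using bin[of i] i by (auto simp: d_def)
      ultimately have "d \<bullet> w < d \<bullet> z"
        unfolding inner_vec_def inner_real_def by (intro sum_strict_mono_ex1) auto
      then show ?thesis by (simp add: h_def a w(2) bqp_point_def)
    qed
    have "convex hull (?S - {a}) \<subseteq> {p. h \<bullet> p < h \<bullet> a}"
      using lt by (intro hull_minimal) (auto simp: convex_halfspace_lt)
    then show ?thesis by auto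
  qed
  have "compact ?S"
    by (simp add: finite_binary_points finite_imp_compact)
  from extreme_point_of_convex_hull_convex_independent[OF this indep]
  show ?thesis
    by (auto simp: bqp_vertices_def boolean_quadric_polytope_def)
qed

lemma card_bqp_vertices: "card bqp_vertices = 16"
proof -
  have "inj_on bqp_point binary_points"
    by (auto simp: inj_on_def bqp_point_def)
  then show ?thesis
    by (simp add: bqp_vertices_eq card_image card_binary_points)
qed

end

theory Submission
  imports Defs
begin

text \<open>
  The point comes from a joint distribution of four binary variables \<open>z\<close>: the linear part \<open>x\<close> and
  the off-diagonal part of \<open>X\<close> are its first and mixed second moments, so they automatically lie in
  the Boolean quadric polytope. A genuine moment matrix would have the diagonal \<open>X\<^sub>i\<^sub>i = x\<^sub>i\<close>. The
  problem, however, ties the diagonal to \<open>x\<close> only through positive semidefiniteness of the bordered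
  matrix, and since the diagonal of \<open>Q\<close> is positive, lowering the \<open>X\<^sub>i\<^sub>i\<close> below \<open>x\<^sub>i\<close> lowers the
  objective, far enough to reach a negative value.

  The distribution has the weights

    \<^item> \<open>7/40\<close> at each of \<open>0000\<close>, \<open>1111\<close>, \<open>0001\<close>, \<open>0111\<close>,
    \<^item> \<open>11/40\<close> at \<open>0011\<close> and \<open>1/40\<close> at \<open>1010\<close>,

  and is invariant under the substitution \<open>z \<mapsto> (1 - z\<^sub>4, 1 - z\<^sub>3, 1 - z\<^sub>2, 1 - z\<^sub>1)\<close>. The quadratic form
  \<open>q z = z \<bullet> (Q *v z) + c \<bullet> z\<close> has this symmetry too, because
  \<open>q z = (z\<^sub>1/2 - z\<^sub>2)\<^sup>2 + (z\<^sub>3 - z\<^sub>4/2)\<^sup>2 - 2 z\<^sub>2 z\<^sub>3 + z\<^sub>1/2 + z\<^sub>2\<close>. The diagonal is chosen invariant as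
  well, which leaves \<open>X\<^sub>1\<^sub>1\<close> and \<open>X\<^sub>2\<^sub>2\<close> free; their values make the objective exactly \<open>-1/100\<close>.
  Positive semidefiniteness is then a matter of completing squares, after the symmetry has split the
  \<open>5 \<times> 5\<close> form into an even part in three variables and an odd part in two
  (lemma \<open>witness_form_nonneg\<close>).
\<close>

text \<open>Every convex combination of the points \<open>bqp_point z\<close> is the image of some \<open>y\<close> in the simplex,
  whatever the enumeration \<open>P\<close> of the vertices: each point is \<open>P k\<close> for some index \<open>k\<close>, whose
  coordinate of \<open>y\<close> receives the weight.\<close>

lemma convex_combination_of_bqp_points:
  fixes P :: "16 \<Rightarrow> (real^4) \<times> (real^6)"
  assumes P: "bij_betw P UNIV bqp_vertices"
    and bin: "\<And>i. i \<in> I \<Longrightarrow> z i \<in> binary_points"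
    and nonneg: "\<And>i. i \<in> I \<Longrightarrow> 0 \<le> w i"
    and total: "sum w I = 1"
  obtains y where "y \<in> std_simplex"
    and "(\<Sum>k\<in>UNIV. y $ k *\<^sub>R P k) = (\<Sum>i\<in>I. w i *\<^sub>R bqp_point (z i))"
proof -
  have "\<exists>k. P k = bqp_point (z i)" if "i \<in> I" for i
  proof -
    have "bqp_point (z i) \<in> range P"
      using P bin[OF that] by (simp add: bij_betw_def bqp_vertices_eq)
    then show ?thesis
      by (metis imageE)
  qed
  then obtain k where k: "P (k i) = bqp_point (z i)" if "i \<in> I" for i
    by metis
  define y :: "real^16" where "y = (\<chi> j. \<Sum>i\<in>I. if k i = j then w i else 0)"
  have "(\<Sum>j\<in>UNIV. y $ j) = sum w I"
    unfolding y_def by (simp add: sum.swap[of _ I])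
  moreover have "0 \<le> y $ j" for j
    using nonneg by (auto simp: y_def intro!: sum_nonneg)
  ultimately have "y \<in> std_simplex"
    using total by (simp add: std_simplex_def)
  moreover have "(\<Sum>j\<in>UNIV. y $ j *\<^sub>R P j) = (\<Sum>i\<in>I. w i *\<^sub>R bqp_point (z i))"
  proof -
    have "(\<Sum>j\<in>UNIV. y $ j *\<^sub>R P j)
        = (\<Sum>j\<in>UNIV. \<Sum>i\<in>I. if k i = j then w i *\<^sub>R P j else 0)"
      by (auto simp: y_def scaleR_sum_left intro!: sum.cong)
    also have "\<dots> = (\<Sum>i\<in>I. w i *\<^sub>R P (k i))"
      by (subst sum.swap) simp
    finally show ?thesis
      by (simp add: k)
  qed
  ultimately show thesis
    by (rule that)
qed

lemma bordered_matrix_quadratic_form: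
  fixes x :: "real^'n" and v :: "real^(1 + 'n)"
  defines "t \<equiv> v $ Inl 1" and "u \<equiv> \<chi> i. v $ Inr i"
  shows "v \<bullet> (bordered_matrix x X *v v) = t\<^sup>2 + 2 * t * (x \<bullet> u) + u \<bullet> (X *v u)"
proof -
  have split: "(\<Sum>i\<in>UNIV. f i) = f (Inl 1) + (\<Sum>i\<in>UNIV. f (Inr i))"
    for f :: "1 + 'n \<Rightarrow> real"
    by (simp flip: UNIV_Plus_UNIV add: sum.Plus)
  show ?thesis
    by (simp add: inner_vec_def matrix_vector_mult_def bordered_matrix_def split t_def u_def
        power2_eq_square sum.distrib sum_distrib_left algebra_simps)
qed

lemma in_shor_set_iff:
  "(x, X) \<in> shor_set \<longleftrightarrow>
    transpose X = X \<and> (\<forall>t u. 0 \<le> t\<^sup>2 + 2 * t * (x \<bullet> u) + u \<bullet> (X *v u))"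
proof -
  have "transpose (bordered_matrix x X) = bordered_matrix x X" if "transpose X = X"
    using that by (auto simp: vec_eq_iff transpose_def bordered_matrix_def split: sum.splits)
  moreover have "(\<forall>v. 0 \<le> v \<bullet> (bordered_matrix x X *v v)) \<longleftrightarrow>
      (\<forall>t u. 0 \<le> t\<^sup>2 + 2 * t * (x \<bullet> u) + u \<bullet> (X *v u))"
    (is "?L \<longleftrightarrow> ?R")
  proof
    assume L: ?L
    show ?R
    proof (intro allI)
      fix t u
      show "0 \<le> t\<^sup>2 + 2 * t * (x \<bullet> u) + u \<bullet> (X *v u)"
        using L[rule_format, of "\<chi> i. case i of Inl _ \<Rightarrow> t | Inr k \<Rightarrow> u $ k"]
        by (simp add: bordered_matrix_quadratic_form)
    qed
  next
    assume ?R
    then show ?L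
      by (simp add: bordered_matrix_quadratic_form)
  qed
  ultimately show ?thesis
    by (auto simp: shor_set_def psd_matrix_def)
qed

lemma forall_6: "(\<forall>i::6. R i) \<longleftrightarrow> R 1 \<and> R 2 \<and> R 3 \<and> R 4 \<and> R 5 \<and> R 6"
proof -
  have "i = 1 \<or> i = 2 \<or> i = 3 \<or> i = 4 \<or> i = 5 \<or> i = 6" for i :: 6
  proof (induct i)
    case (of_int k)
    then have "k = 0 \<or> k = 1 \<or> k = 2 \<or> k = 3 \<or> k = 4 \<or> k = 5"
      by simp arith
    then show ?case
      by auto
  qed
  then show ?thesis
    by metis
qed

definition witness_x :: "real^4" where
  "witness_x = vector [1/5, 7/20, 13/20, 4/5]"

definition witness_X :: "real^4^4" where
  "witness_X = vector [vector [29/200,   7/40,     1/5,  7/40],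
                       vector [  7/40, 207/800,   7/20,  7/20],
                       vector [   1/5,   7/20, 447/800,   5/8],
                       vector [  7/40,   7/20,     5/8, 149/200]]"

text \<open>Read the form as the expectation of \<open>(t + a z\<^sub>1 + b z\<^sub>2 + c z\<^sub>3 + d z\<^sub>4)\<^sup>2\<close>, where the first
  and second moments of \<open>z\<close> are the entries of \<open>witness_x\<close> and \<open>witness_X\<close>. The functions
  \<open>1\<close>, \<open>z\<^sub>1 - z\<^sub>4\<close>, \<open>z\<^sub>2 - z\<^sub>3\<close> are even and \<open>z\<^sub>1 + z\<^sub>4 - 1\<close>, \<open>z\<^sub>2 + z\<^sub>3 - 1\<close> are odd under
  \<open>z \<mapsto> (1 - z\<^sub>4, 1 - z\<^sub>3, 1 - z\<^sub>2, 1 - z\<^sub>1)\<close>, so no mixed terms occur between the two groups. The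
  locals \<open>T, \<beta>, \<delta>\<close> and \<open>\<alpha>, \<gamma>\<close> are the coefficients in these two groups.\<close>

lemma witness_form_nonneg:
  fixes t a b c d :: real
  shows "0 \<le> t\<^sup>2 + 2 * t * (a/5 + 7*b/20 + 13*c/20 + 4*d/5)
      + 29*a\<^sup>2/200 + 207*b\<^sup>2/800 + 447*c\<^sup>2/800 + 149*d\<^sup>2/200
      + 2 * (7*a*b/40 + a*c/5 + 7*a*d/40 + 7*b*c/20 + 7*b*d/20 + 5*c*d/8)"
    (is "0 \<le> ?q")
proof -
  define T where "T = t + (a + b + c + d) / 2"
  define \<alpha> \<beta> \<gamma> \<delta> where "\<alpha> = (a + d) / 2" and "\<beta> = (a - d) / 2"
    and "\<gamma> = (b + c) / 2" and "\<delta> = (b - c) / 2"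
  have "?q = (T - 3/5 * \<beta> - 3/10 * \<delta>)\<^sup>2 + 9/50 * (\<beta> + 7/18 * \<delta>)\<^sup>2 + 1/3600 * \<delta>\<^sup>2
      + (6/25 * (\<alpha> + 35/24 * \<gamma>)\<^sup>2 + 17/2400 * \<gamma>\<^sup>2)"
    unfolding T_def \<alpha>_def \<beta>_def \<gamma>_def \<delta>_def
    by (simp add: power2_eq_square field_simps)
  also have "\<dots> \<ge> 0"
    by simp
  finally show ?thesis .
qed

lemma witness_in_shor_set: "(witness_x, witness_X) \<in> shor_set"
proof -
  have "transpose witness_X = witness_X"
    by (simp add: vec_eq_iff transpose_def forall_4 witness_X_def vector_4)
  moreover have "0 \<le> t\<^sup>2 + 2 * t * (witness_x \<bullet> u) + u \<bullet> (witness_X *v u)" for t u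
    using witness_form_nonneg[of t "u $ 1" "u $ 2" "u $ 3" "u $ 4"]
    by (simp add: witness_x_def witness_X_def inner_vec_def matrix_vector_mult_def sum_4 vector_4
        power2_eq_square field_simps)
  ultimately show ?thesis
    by (simp add: in_shor_set_iff)
qed

theorem proposition3:
  fixes P :: "16 \<Rightarrow> (real^4) \<times> (real^6)"
    and Q :: "real^4^4" and c :: "real^4"
  assumes P: "bij_betw P UNIV bqp_vertices"
    and Q: "Q = vector [vector [ 1/4, -1/2,    0,    0],
                        vector [-1/2,    1,   -1,    0],
                        vector [   0,   -1,    1, -1/2],
                        vector [   0,    0, -1/2,  1/4]]"
    and c: "c = vector [1/2, 1, 0, 0]"
  shows "\<exists>x X y. (x, X, y) \<in> bqp_feasible P \<and> qp_objective Q c x X = - 1 / 100"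
proof -
  \<comment> \<open>The support and the weights of the distribution with moments \<open>witness_x\<close> and, off the
    diagonal, \<open>witness_X\<close>.\<close>
  define z :: "nat \<Rightarrow> real^4" where
    "z i = [vector [0,0,0,0], vector [1,1,1,1], vector [0,0,0,1],
            vector [0,1,1,1], vector [0,0,1,1], vector [1,0,1,0]] ! i" for i
  define w :: "nat \<Rightarrow> real" where
    "w i = [7/40, 7/40, 7/40, 7/40, 11/40, 1/40] ! i" for i
  have six: "{..<6} = {0, 1, 2, 3, 4, 5 :: nat}"
    by auto
  have "z i \<in> binary_points" if "i \<in> {..<6}" for i
    using that unfolding six by (auto simp: z_def binary_points_def forall_4 vector_4)
  moreover have "0 \<le> w i" if "i \<in> {..<6}" for i
    using that unfolding six by (auto simp: w_def)
  moreover have "sum w {..<6} = 1"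
    by (simp add: six w_def)
  ultimately obtain y where y: "y \<in> std_simplex"
    and combination: "(\<Sum>k\<in>UNIV. y $ k *\<^sub>R P k) = (\<Sum>i\<in>{..<6}. w i *\<^sub>R bqp_point (z i))"
    by (rule convex_combination_of_bqp_points[OF P])
  have "(\<Sum>i\<in>{..<6}. w i *\<^sub>R z i) = witness_x"
    by (simp add: six w_def z_def witness_x_def vec_eq_iff forall_4 vector_4)
  moreover have "(\<Sum>i\<in>{..<6}. w i *\<^sub>R upper_entries (\<chi> j k. z i $ j * z i $ k))
      = upper_entries witness_X"
    by (simp add: six w_def z_def witness_X_def upper_entries_def vec_eq_iff forall_6 vector_4
        vector_6)
  ultimately have "(\<Sum>k\<in>UNIV. y $ k *\<^sub>R P k) = (witness_x, upper_entries witness_X)"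
    unfolding combination by (simp add: prod_eq_iff fst_sum snd_sum bqp_point_def)
  then have "(witness_x, witness_X, y) \<in> bqp_feasible P"
    using y witness_in_shor_set by (simp add: bqp_feasible_def)
  moreover have "qp_objective Q c witness_x witness_X = - 1 / 100"
    by (simp add: qp_objective_def Q c witness_x_def witness_X_def inner_vec_def sum_4 vector_4)
  ultimately show ?thesis
    by blast
qed

end
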